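(* Let $F$ be a field, let $A$ be a finite subset of $F$, let $n,k\in\mathbb{Z}^+$, and let $$f(x_1,\ldots,x_n)=a_1x_1^k+\cdots+a_nx_n^k+g(x_1,\ldots,x_n)\in F[x_1,\ldots,x_n],$$ where $a_1,\ldots,a_n\in F\setminus\{0\}$ and $g\in F[x_1,\ldots,x_n]$ has $\deg g<k$. Write $|A|=kq+r$ with $q,r\in\mathbb{N}$ and $r<k$. Then $$|\{f(x_1,\ldots,x_n):\ x_1,\ldots,x_n\in A,\ \text{and}\ x_i\neq x_j\ \text{if}\ i\neq j\}|\geq\begin{cases}\min\{p(F),\ n(q-1)+\min\{n,r\}+1\}&\text{if}\ n\leq k,\\ \min\{p(F),\ |A|-n+1\}&\text{if}\ n\geq k.\end{cases}$$
   Context: $\mathbb{Z}^+=\{1,2,3,\ldots\}$ and $\mathbb{N}=\{0,1,2,\ldots\}$. For a field $F$, $p(F)$ denotes the additive order of the multiplicative identity of $F$: $p(F)=p$ if $F$ has prime characteristic $p$, and $p(F)=+\infty$ if $F$ has characteristic zero. $\deg g$ is the total degree of $g$; the zero polynomial is allowed as $g$ (its degree is regarded as less than $k$). The lower bounds are computed as integers (possibly negative), not with truncated subtraction. *)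

theory Defs
  imports "HOL-Library.Poly_Mapping" "HOL-Library.Extended_Real"
begin

text \<open>
  A monomial is a finitely supported exponent function, and a polynomial is a finitely supported
  map from monomials to coefficients. The variables are indexed by all natural numbers;
  membership in $F[x_1,\dots,x_n]$ is expressed by \<open>mpolys {1..n}\<close> below. The ring structure
  is the convolution product of \<^theory>\<open>HOL-Library.Poly_Mapping\<close>.
\<close>

type_synonym 'a mpoly = "(nat \<Rightarrow>\<^sub>0 nat) \<Rightarrow>\<^sub>0 'a"

definition Const :: "'a::zero \<Rightarrow> 'a mpoly"
  where "Const c = Poly_Mapping.single 0 c"

definition Var :: "nat \<Rightarrow> 'a::zero_neq_one mpoly"
  where "Var i = Poly_Mapping.single (Poly_Mapping.single i 1) 1"

definition mpolys :: "nat set \<Rightarrow> 'a::zero mpoly set"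
  where "mpolys V = {p. \<forall>m \<in> Poly_Mapping.keys p. Poly_Mapping.keys m \<subseteq> V}"

definition monom_degree :: "(nat \<Rightarrow>\<^sub>0 nat) \<Rightarrow> nat"
  where "monom_degree m = (\<Sum>i \<in> Poly_Mapping.keys m. Poly_Mapping.lookup m i)"

text \<open>The zero polynomial gets degree 0, so it satisfies \<open>total_degree g < k\<close> for every \<open>k \<ge> 1\<close>.\<close>

definition total_degree :: "'a::zero mpoly \<Rightarrow> nat"
  where "total_degree p = Max (insert 0 (monom_degree ` Poly_Mapping.keys p))"

definition mpoly_eval :: "'a::comm_semiring_1 mpoly \<Rightarrow> (nat \<Rightarrow> 'a) \<Rightarrow> 'a"
  where "mpoly_eval p x =
    (\<Sum>m \<in> Poly_Mapping.keys p.
       Poly_Mapping.lookup p m * (\<Prod>i \<in> Poly_Mapping.keys m. x i ^ Poly_Mapping.lookup m i))"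

text \<open>
  The additive order of \<open>1\<close>. The library's \<open>CHAR('a)\<close> is \<open>0\<close> in characteristic zero, where the
  additive order is infinite.
\<close>

definition add_order_one :: "'a::field itself \<Rightarrow> ereal"
  where "add_order_one _ = (if CHAR('a) = 0 then \<infinity> else ereal (real CHAR('a)))"

end

theory Submission
  imports Defs "Jordan_Normal_Form.Determinant"
begin

text \<open>
  Let $n \le k$ and choose $m_i \le \lfloor (|A| - i - 1)/k \rfloor$ for $i < n$ and
  $N = \sum_i m_i$ smaller than $p(F)$. If $f$ took at most $N$ values on distinct arguments, all
  among $c_0, \dots, c_{N-1}$, then $P = \prod_j (f - c_j) \cdot \det (x_i^j)$ would vanish on
  every box $\prod_i B_i$ with $B_i \subseteq A$, $|B_i| = k m_i + i + 1$. The degree of $P$ is at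
  most $\sum_i (|B_i| - 1)$, so the coefficient of $\prod_i x_i^{k m_i + i}$ in $P$ is a weighted
  sum of its values on the box and vanishes as well. As $n \le k$, exponents below $n$ are
  determined modulo $k$, so only the diagonal term of the determinant contributes to this
  coefficient, which is therefore $\frac{N!}{\prod_i m_i!} \prod_i a_i^{m_i} \ne 0$.
  For $n > k$, fix the last $n - k$ variables at distinct elements of $A$ and remove these from $A$.
\<close>

section \<open>Polynomial functions of bounded degree\<close>

text \<open>
  The variables are numbered from 0, unlike in \<open>mpolys {1..n}\<close>. The bound is strict so that
  \<open>D = 0\<close> describes the zero function.
\<close>

inductive poly_deg_less :: "nat \<Rightarrow> nat \<Rightarrow> ((nat \<Rightarrow> 'a::comm_ring_1) \<Rightarrow> 'a) \<Rightarrow> bool"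
  for n D where
  zero: "poly_deg_less n D (\<lambda>x. 0)"
| add_monom: "poly_deg_less n D h \<Longrightarrow> (\<Sum>i<n. m i) < D
    \<Longrightarrow> poly_deg_less n D (\<lambda>x. c * (\<Prod>i<n. x i ^ m i) + h x)"

lemma poly_deg_less_monom:
  assumes "(\<Sum>i<n. m i) < D"
  shows "poly_deg_less n D (\<lambda>x. c * (\<Prod>i<n. x i ^ m i))"
  using poly_deg_less.add_monom[OF poly_deg_less.zero assms, of c] by simp

lemma poly_deg_less_const: "0 < D \<Longrightarrow> poly_deg_less n D (\<lambda>x. c)"
  using poly_deg_less_monom[of "\<lambda>_. 0" n D c] by simp

lemma poly_deg_less_add:
  assumes "poly_deg_less n D f" "poly_deg_less n D g"
  shows "poly_deg_less n D (\<lambda>x. f x + g x)"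
  using assms(1)
proof induction
  case zero
  then show ?case using assms(2) by simp
next
  case (add_monom h m c)
  then show ?case
    using poly_deg_less.add_monom[OF add_monom.IH add_monom.hyps(2), of c] by (simp add: add.assoc)
qed

lemma poly_deg_less_sum:
  assumes "\<And>j. j \<in> J \<Longrightarrow> poly_deg_less n D (f j)"
  shows "poly_deg_less n D (\<lambda>x. \<Sum>j\<in>J. f j x)"
  using assms
  by (induction J rule: infinite_finite_induct)
    (auto intro: poly_deg_less.zero poly_deg_less_add)

lemma poly_deg_less_mult_monom:
  assumes "poly_deg_less n D f" "D + (\<Sum>i<n. m i) \<le> E"
  shows "poly_deg_less n E (\<lambda>x. c * (\<Prod>i<n. x i ^ m i) * f x)"
  using assms(1)
proof induction
  case zero
  then show ?case by (simp add: poly_deg_less.zero)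
next
  case (add_monom h m' c')
  have "(\<Sum>i<n. m i + m' i) < E"
    using add_monom.hyps assms(2) by (simp add: sum.distrib)
  from poly_deg_less.add_monom[OF add_monom.IH this, of "c * c'"]
  show ?case by (simp add: algebra_simps power_add prod.distrib)
qed

text \<open>The first factor has degree below \<open>D\<close>, the second at most \<open>E\<close>.
  This asymmetry avoids subtracting 1 and stays valid for \<open>D = 0\<close>, where
  \<open>f\<close> is zero.\<close>

lemma poly_deg_less_mult:
  assumes "poly_deg_less n D f" "poly_deg_less n (Suc E) g"
  shows "poly_deg_less n (D + E) (\<lambda>x. f x * g x)"
  using assms(2)
proof induction
  case zero
  then show ?case by (simp add: poly_deg_less.zero)
next
  case (add_monom h m c)
  have "poly_deg_less n (D + E) (\<lambda>x. c * (\<Prod>i<n. x i ^ m i) * f x)"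
    using add_monom.hyps by (intro poly_deg_less_mult_monom[OF assms(1)]) auto
  from poly_deg_less_add[OF this add_monom.IH]
  show ?case by (simp add: algebra_simps)
qed

lemma poly_deg_less_mono:
  assumes "poly_deg_less n D f" "D \<le> E"
  shows "poly_deg_less n E f"
  using poly_deg_less_mult_monom[OF assms(1), of "\<lambda>_. 0" E 1] assms(2) by simp

lemma poly_deg_less_power:
  assumes "poly_deg_less n (Suc D) f"
  shows "poly_deg_less n (Suc (D * N)) (\<lambda>x. f x ^ N)"
proof (induction N)
  case 0
  then show ?case by (simp add: poly_deg_less_const)
next
  case (Suc N)
  from poly_deg_less_mult[OF this assms] show ?case by (simp add: mult.commute add.commute)
qed

lemma poly_deg_less_cong:
  assumes "poly_deg_less n D f" "\<And>i. i < n \<Longrightarrow> x i = y i"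
  shows "f x = f y"
  using assms(1)
proof induction
  case (add_monom h m c)
  have "(\<Prod>i<n. x i ^ m i) = (\<Prod>i<n. y i ^ m i)"
    using assms(2) by (intro prod.cong) auto
  then show ?case using add_monom.IH by simp
qed simp

lemma poly_deg_less_fix_tail:
  assumes "poly_deg_less n D f" "k \<le> n"
  shows "poly_deg_less k D (\<lambda>x. f (\<lambda>i. if i < k then x i else b i))"
  using assms(1)
proof induction
  case zero
  show ?case by (rule poly_deg_less.zero)
next
  case (add_monom h m c)
  have split: "{..<n} = {..<k} \<union> {k..<n}" "{..<k} \<inter> {k..<n} = {}"
    using assms(2) by auto
  have "(\<Sum>i<k. m i) < D"
    using add_monom.hyps(2) sum_mono2[of "{..<n}" "{..<k}" m] assms(2) by fastforce
  from poly_deg_less.add_monom[OF add_monom.IH this, of "c * (\<Prod>i=k..<n. b i ^ m i)"]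
  show ?case
    unfolding split(1) by (subst prod.union_disjoint) (auto simp: algebra_simps)
qed

lemma poly_deg_less_power_sum:
  "poly_deg_less n (Suc k) (\<lambda>x. \<Sum>i<n. a i * x i ^ k)"
proof (rule poly_deg_less_sum)
  fix j assume "j \<in> {..<n}"
  then have "(\<lambda>x::nat \<Rightarrow> 'a. a j * x j ^ k) =
      (\<lambda>x. a j * (\<Prod>i<n. x i ^ (if i = j then k else 0)))"
    by (intro ext) (simp add: if_distrib prod.delta cong: if_cong)
  then show "poly_deg_less n (Suc k) (\<lambda>x. a j * x j ^ k)"
    using \<open>j \<in> {..<n}\<close> by (simp only:) (rule poly_deg_less_monom, simp)
qed

lemma poly_deg_less_power_sum_add:
  assumes "poly_deg_less n k g"
  shows "poly_deg_less n (Suc k) (\<lambda>x. (\<Sum>i<n. a i * x i ^ k) + g x)"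
  using poly_deg_less_add[OF poly_deg_less_power_sum poly_deg_less_mono[OF assms, of "Suc k"]]
  by simp

text \<open>In the expanded product every term except \<open>T x ^ N\<close> uses some
  \<open>g x - c j\<close>, of degree below \<open>k\<close>, in place of a factor
  \<open>T x\<close> of degree at most \<open>k\<close>.\<close>

lemma poly_deg_less_prod_diff_power:
  assumes "poly_deg_less n (Suc k) T" "poly_deg_less n k g" "k \<ge> 1"
  shows "poly_deg_less n (k * N) (\<lambda>x. (\<Prod>j<N. T x + g x - c j) - T x ^ N)"
proof (induction N)
  case 0
  then show ?case by (simp add: poly_deg_less.zero)
next
  case (Suc N)
  \<comment> \<open>Here \<open>k \<ge> 1\<close> matters: it gives the constant \<open>c N\<close>
    degree below \<open>k\<close>.\<close>
  have low: "poly_deg_less n k (\<lambda>x. g x + (- c N))"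
    using assms by (intro poly_deg_less_add poly_deg_less_const) auto
  then have "poly_deg_less n (Suc k) (\<lambda>x. T x + (g x + (- c N)))"
    using poly_deg_less_add[OF assms(1) poly_deg_less_mono[OF low, of "Suc k"]] by simp
  from poly_deg_less_mult[OF Suc this]
  have "poly_deg_less n (k * Suc N)
      (\<lambda>x. ((\<Prod>j<N. T x + g x - c j) - T x ^ N) * (T x + (g x + (- c N))))"
    by (simp add: add.commute)
  moreover have "poly_deg_less n (k * Suc N) (\<lambda>x. (g x + (- c N)) * T x ^ N)"
    using poly_deg_less_mult[OF low poly_deg_less_power[OF assms(1), of N]] by simp
  \<comment> \<open>This is the difference for \<open>Suc N\<close>: the old difference times the
    new factor, plus the low part of the new factor times \<open>T x ^ N\<close>.\<close>
  ultimately have "poly_deg_less n (k * Suc N)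
      (\<lambda>x. ((\<Prod>j<N. T x + g x - c j) - T x ^ N) * (T x + (g x + (- c N)))
         + (g x + (- c N)) * T x ^ N)"
    by (rule poly_deg_less_add)
  then show ?case by (simp add: algebra_simps)
qed

section \<open>Coefficient extraction on a box\<close>

text \<open>
  The weights are $1 / \prod_{c \in B \setminus \{b\}} (b - c)$; adding a point $z$ to $B$ divides
  the old ones by $b - z$.
\<close>

lemma top_power_weights_exist:
  fixes B :: "'a::field set"
  assumes "finite B" "card B = Suc d"
  shows "\<exists>w. \<forall>e\<le>d. (\<Sum>b\<in>B. w b * b ^ e) = (if e = d then 1 else 0)"
  using assms
proof (induction d arbitrary: B)
  case 0
  then obtain b where "B = {b}" by (auto simp: card_Suc_eq)
  then show ?case by (intro exI[of _ "\<lambda>_. 1"]) simp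
next
  case (Suc d)
  then obtain z C where B: "B = insert z C" "z \<notin> C" "card C = Suc d" "finite C"
    by (metis card_Suc_eq finite_insert)
  from Suc.IH[OF B(4,3)] obtain w
    where w: "\<And>e. e \<le> d \<Longrightarrow> (\<Sum>b\<in>C. w b * b ^ e) = (if e = d then 1 else 0)" by blast
  define v where "v b = w b / (b - z)" for b
  \<comment> \<open>The weight at \<open>z\<close> makes the new weights sum to 0, which settles
    exponent 0.\<close>
  define u where "u b = (if b = z then - sum v C else v b)" for b
  have uC: "(\<Sum>b\<in>C. u b * h b) = (\<Sum>b\<in>C. v b * h b)" for h
    using B(2) by (intro sum.cong) (auto simp: u_def)
  \<comment> \<open>Splitting \<open>b ^ Suc e\<close> as \<open>(b - z) * b ^ e + z * b ^ e\<close>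
    cancels the denominators. The recursion starts at 0, and its first nonzero input is the moment
    of \<open>w\<close> at \<open>d\<close>.\<close>
  have step: "(\<Sum>b\<in>B. u b * b ^ Suc e) = (\<Sum>b\<in>C. w b * b ^ e) + z * (\<Sum>b\<in>B. u b * b ^ e)" for e
  proof -
    have "(\<Sum>b\<in>C. v b * b ^ Suc e) = (\<Sum>b\<in>C. w b * b ^ e + z * (v b * b ^ e))"
    proof (intro sum.cong refl)
      fix b assume "b \<in> C"
      then have "b - z \<noteq> 0" using B(2) by auto
      then have w_b: "w b = v b * (b - z)" by (simp add: v_def)
      show "v b * b ^ Suc e = w b * b ^ e + z * (v b * b ^ e)"
        unfolding w_b by (simp add: algebra_simps)
    qed
    then show ?thesis
      using B by (simp add: uC sum.distrib distrib_left flip: sum_distrib_left)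
  qed
  have "(\<Sum>b\<in>B. u b * b ^ e) = (if e = Suc d then 1 else 0)" if "e \<le> Suc d" for e
    using that
  proof (induction e)
    case 0
    then show ?case using B uC[of "\<lambda>_. 1"] by (simp add: u_def)
  next
    case (Suc e)
    then show ?case using step[of e] w[of e] by simp
  qed
  then show ?case by blast
qed

text \<open>The tensor product of the one-variable functionals with weights \<open>w i\<close> on
  \<open>B i\<close>; on monomials it factors into their moments.\<close>

definition weighted_sum ::
  "nat \<Rightarrow> (nat \<Rightarrow> 'a::comm_ring_1 set) \<Rightarrow> (nat \<Rightarrow> 'a \<Rightarrow> 'a) \<Rightarrow> ((nat \<Rightarrow> 'a) \<Rightarrow> 'a) \<Rightarrow> 'a" where
  "weighted_sum n B w P = (\<Sum>x\<in>PiE {..<n} B. (\<Prod>i<n. w i (x i)) * P x)"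

lemma weighted_sum_add:
  "weighted_sum n B w (\<lambda>x. P x + Q x) = weighted_sum n B w P + weighted_sum n B w Q"
  by (simp add: weighted_sum_def sum.distrib algebra_simps)

lemma weighted_sum_mult_left:
  "weighted_sum n B w (\<lambda>x. c * P x) = c * weighted_sum n B w P"
  by (simp add: weighted_sum_def sum_distrib_left algebra_simps)

lemma weighted_sum_sum:
  "weighted_sum n B w (\<lambda>x. \<Sum>j\<in>J. P j x) = (\<Sum>j\<in>J. weighted_sum n B w (P j))"
  unfolding weighted_sum_def by (subst sum.swap) (simp add: sum_distrib_left)

lemma weighted_sum_monom:
  assumes "\<And>i. i < n \<Longrightarrow> finite (B i)"
  shows "weighted_sum n B w (\<lambda>x. \<Prod>i<n. x i ^ e i) = (\<Prod>i<n. \<Sum>b\<in>B i. w i b * b ^ e i)"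
  unfolding weighted_sum_def
  by (subst prod_sum_PiE) (use assms in \<open>auto simp: prod.distrib\<close>)

text \<open>Moments beyond \<open>d i\<close> are left unspecified, so the weighted sum reads off
  the coefficient at the exponents \<open>d i\<close> only for polynomials of total degree at most
  the sum of the \<open>d i\<close>.\<close>

locale top_monomial_weights =
  fixes n :: nat and d :: "nat \<Rightarrow> nat" and B :: "nat \<Rightarrow> 'a::field set" and w :: "nat \<Rightarrow> 'a \<Rightarrow> 'a"
  assumes finite_B: "i < n \<Longrightarrow> finite (B i)"
    and weights: "i < n \<Longrightarrow> e \<le> d i \<Longrightarrow> (\<Sum>b\<in>B i. w i b * b ^ e) = (if e = d i then 1 else 0)"
begin

abbreviation L :: "((nat \<Rightarrow> 'a) \<Rightarrow> 'a) \<Rightarrow> 'a" where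
  "L \<equiv> weighted_sum n B w"

text \<open>One vanishing factor suffices, so exponents above \<open>d\<close> at other indices do
  no harm.\<close>

lemma L_monom_eq_0:
  assumes "i < n" "e i < d i"
  shows "L (\<lambda>x. \<Prod>i<n. x i ^ e i) = 0"
  using assms by (subst weighted_sum_monom) (auto simp: finite_B weights intro!: bexI[of _ i])

lemma L_monom_top: "(\<And>i. i < n \<Longrightarrow> e i = d i) \<Longrightarrow> L (\<lambda>x. \<Prod>i<n. x i ^ e i) = 1"
  by (subst weighted_sum_monom) (auto simp: finite_B weights intro!: prod.neutral)

text \<open>A monomial whose degree is below the sum of the \<open>d i\<close> has some exponent
  \<open>m i < d i\<close>, as in the Combinatorial Nullstellensatz.\<close>

lemma L_low_degree:
  assumes "poly_deg_less n (\<Sum>i<n. d i) h"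
  shows "L h = 0"
  using assms
proof induction
  case zero
  then show ?case by (simp add: weighted_sum_def)
next
  case (add_monom h m c)
  from add_monom.hyps(2) obtain i where "i < n" "m i < d i"
    by (metis lessThan_iff not_le sum_mono)
  then show ?case
    using add_monom.IH by (simp add: weighted_sum_add weighted_sum_mult_left L_monom_eq_0)
qed

text \<open>
  Peeling off one factor of the power at a time takes the place of the multinomial theorem in the
  next three lemmas about \<open>L\<close>.
\<close>

lemma L_power_sum_Suc:
  "L (\<lambda>x. (\<Sum>j<n. a j * x j ^ k) ^ Suc N * (\<Prod>i<n. x i ^ e i)) =
   (\<Sum>j<n. a j * L (\<lambda>x. (\<Sum>j<n. a j * x j ^ k) ^ N * (\<Prod>i<n. x i ^ (e(j := e j + k)) i)))"
proof -
  have shift: "(\<Prod>i<n. x i ^ (e(j := e j + k)) i) = x j ^ k * (\<Prod>i<n. x i ^ e i)"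
    if "j < n" for j and x :: "nat \<Rightarrow> 'a"
    using that by (simp add: prod.remove[of "{..<n}" j] power_add algebra_simps)
  have "(\<Sum>j<n. a j * x j ^ k) ^ Suc N * (\<Prod>i<n. x i ^ e i) =
      (\<Sum>j<n. a j * ((\<Sum>j<n. a j * x j ^ k) ^ N * (\<Prod>i<n. x i ^ (e(j := e j + k)) i)))"
    for x :: "nat \<Rightarrow> 'a"
  proof -
    define s where "s = (\<Sum>j<n. a j * x j ^ k)"
    define p where "p = (\<Prod>i<n. x i ^ e i)"
    have "s ^ Suc N * p = (\<Sum>j<n. a j * x j ^ k) * (s ^ N * p)"
      by (simp add: s_def algebra_simps)
    also have "\<dots> = (\<Sum>j<n. a j * (s ^ N * (\<Prod>i<n. x i ^ (e(j := e j + k)) i)))"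
      unfolding sum_distrib_right
    proof (intro sum.cong refl)
      fix j assume "j \<in> {..<n}"
      then have "(\<Prod>i<n. x i ^ (e(j := e j + k)) i) = x j ^ k * p"
        unfolding p_def by (intro shift) simp
      then show "a j * x j ^ k * (s ^ N * p) =
          a j * (s ^ N * (\<Prod>i<n. x i ^ (e(j := e j + k)) i))"
        by (simp only: mult_ac)
    qed
    finally show ?thesis unfolding s_def p_def .
  qed
  then show ?thesis
    by (simp only: weighted_sum_sum weighted_sum_mult_left)
qed

lemma sum_shifted_exponent:
  fixes e :: "nat \<Rightarrow> nat"
  assumes "j < n"
  shows "(\<Sum>i<n. (e(j := e j + k)) i) = (\<Sum>i<n. e i) + k"
  using assms by (simp add: sum.remove[of "{..<n}" j])

lemma L_power_sum_eq_0:
  assumes "(\<Sum>i<n. e i) + k * N = (\<Sum>i<n. d i)" "i < n" "\<And>m. d i \<noteq> e i + k * m"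
  shows "L (\<lambda>x. (\<Sum>j<n. a j * x j ^ k) ^ N * (\<Prod>i<n. x i ^ e i)) = 0"
  using assms
proof (induction N arbitrary: e)
  case 0
  \<comment> \<open>Both exponent vectors have the same sum, so without a deficit they would agree
    everywhere; the assumption with \<open>m = 0\<close> forbids this at \<open>i\<close>.\<close>
  have "\<exists>i<n. e i < d i"
  proof (rule ccontr)
    assume "\<not> ?thesis"
    then have le: "\<And>i. i < n \<Longrightarrow> d i \<le> e i" by (meson not_le)
    moreover have "d i < e i" using 0(3)[of 0] le[OF 0(2)] by simp
    ultimately have "(\<Sum>i<n. d i) < (\<Sum>i<n. e i)"
      using 0(2) by (intro sum_strict_mono_ex1) auto
    then show False using 0(1) by simp
  qed
  then show ?case by (auto simp: L_monom_eq_0)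
next
  case (Suc N)
  have "L (\<lambda>x. (\<Sum>j<n. a j * x j ^ k) ^ N * (\<Prod>i<n. x i ^ (e(j := e j + k)) i)) = 0"
    if "j < n" for j
  proof (rule Suc.IH)
    show "(\<Sum>i<n. (e(j := e j + k)) i) + k * N = (\<Sum>i<n. d i)"
      using Suc.prems(1) that by (simp add: sum_shifted_exponent del: fun_upd_apply)
    \<comment> \<open>Raising \<open>e i\<close> by \<open>k\<close> only turns \<open>m\<close>
      into \<open>Suc m\<close>, so the obstruction at \<open>i\<close> survives.\<close>
    show "d i \<noteq> (e(j := e j + k)) i + k * m" for m
      using Suc.prems(3)[of m] Suc.prems(3)[of "Suc m"] by auto
  qed fact
  then show ?case by (simp add: L_power_sum_Suc del: fun_upd_apply power_Suc)
qed

text \<open>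
  The factorials stand on the left since a single one may vanish in \<open>'a\<close>.
\<close>

lemma L_power_sum:
  assumes "\<And>i. i < n \<Longrightarrow> d i = e i + k * m i" "(\<Sum>i<n. m i) = N" "k \<ge> 1"
  shows "(\<Prod>i<n. of_nat (fact (m i))) * L (\<lambda>x. (\<Sum>j<n. a j * x j ^ k) ^ N * (\<Prod>i<n. x i ^ e i)) =
    of_nat (fact N) * (\<Prod>i<n. a i ^ m i)"
  using assms(1,2)
proof (induction N arbitrary: e m)
  case 0
  then show ?case by (simp add: L_monom_top)
next
  case (Suc N)
  define \<Phi> where
    "\<Phi> j = L (\<lambda>x. (\<Sum>j<n. a j * x j ^ k) ^ N * (\<Prod>i<n. x i ^ (e(j := e j + k)) i))" for j
  \<comment> \<open>Peeling off index \<open>j\<close> contributes the share \<open>m j\<close>; the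
    shares add up to \<open>Suc N\<close>, which completes the factorial.\<close>
  have "(\<Prod>i<n. of_nat (fact (m i))) * (a j * \<Phi> j) = of_nat (m j) * (of_nat (fact N) * (\<Prod>i<n. a i ^ m i))"
    if j: "j < n" for j
  proof (cases "m j")
    case 0
    \<comment> \<open>The raised exponent overshoots \<open>d j = e j\<close>, and further factors
      can only increase it.\<close>
    have "\<Phi> j = 0" unfolding \<Phi>_def
    proof (rule L_power_sum_eq_0[of _ _ _ j])
      have "(\<Sum>i<n. d i) = (\<Sum>i<n. e i) + k * Suc N"
        using Suc.prems by (simp add: sum.distrib flip: sum_distrib_left)
      then show "(\<Sum>i<n. (e(j := e j + k)) i) + k * N = (\<Sum>i<n. d i)"
        using j by (simp add: sum_shifted_exponent del: fun_upd_apply)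
      show "d j \<noteq> (e(j := e j + k)) j + k * m'" for m'
        using Suc.prems(1)[OF j] 0 assms(3) by simp
    qed fact
    then show ?thesis using 0 by simp
  next
    case (Suc l)
    \<comment> \<open>One factor \<open>a j\<close> is spent;
      \<open>fact (Suc l) = Suc l * fact l\<close> supplies the multiplier
      \<open>m j\<close>.\<close>
    define m' where "m' = m(j := l)"
    have rem: "\<And>h :: nat \<Rightarrow> 'a. (\<Prod>i<n. h i) = h j * (\<Prod>i\<in>{..<n}-{j}. h i)"
      using j by (simp add: prod.remove)
    have "(\<Prod>i<n. of_nat (fact (m' i))) * \<Phi> j = of_nat (fact N) * (\<Prod>i<n. a i ^ m' i)"
      unfolding \<Phi>_def
    proof (rule Suc.IH)
      show "d i = (e(j := e j + k)) i + k * m' i" if "i < n" for i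
        using Suc.prems(1)[OF that] Suc by (simp add: m'_def)
      have "(\<Sum>i<n. m i) = Suc (\<Sum>i<n. m' i)"
        using j Suc by (simp add: m'_def sum.remove[of "{..<n}" j])
      then show "(\<Sum>i<n. m' i) = N" using Suc.prems(2) by simp
    qed
    moreover have "(\<Prod>i<n. of_nat (fact (m i))) = (of_nat (m j) * (\<Prod>i<n. of_nat (fact (m' i))) :: 'a)"
      unfolding rem using Suc by (simp add: m'_def algebra_simps)
    moreover have "(\<Prod>i<n. a i ^ m i) = a j * (\<Prod>i<n. a i ^ m' i)"
      unfolding rem using Suc by (simp add: m'_def algebra_simps)
    ultimately show ?thesis by (simp add: algebra_simps)
  qed
  then have "(\<Prod>i<n. of_nat (fact (m i))) * (\<Sum>j<n. a j * \<Phi> j) =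
      (\<Sum>j<n. of_nat (m j) * (of_nat (fact N) * (\<Prod>i<n. a i ^ m i)))"
    by (simp add: sum_distrib_left)
  also have "\<dots> = of_nat (\<Sum>j<n. m j) * (of_nat (fact N) * (\<Prod>i<n. a i ^ m i))"
    by (simp add: sum_distrib_right)
  also have "\<dots> = of_nat (fact (Suc N)) * (\<Prod>i<n. a i ^ m i)"
    using Suc.prems(2) by (simp add: algebra_simps)
  finally show ?case by (simp add: L_power_sum_Suc \<Phi>_def del: fun_upd_apply power_Suc)
qed

end

section \<open>Values on distinct arguments\<close>

definition vandermonde_det :: "nat \<Rightarrow> (nat \<Rightarrow> 'a::comm_ring_1) \<Rightarrow> 'a" where
  "vandermonde_det n x = det (mat n n (\<lambda>(i, j). x i ^ j))"

lemma vandermonde_det_expand: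
  "vandermonde_det n x = (\<Sum>p | p permutes {..<n}. signof p * (\<Prod>i<n. x i ^ p i))"
proof -
  have "(\<Prod>i = 0..<n. mat n n (\<lambda>(i, j). x i ^ j) $$ (i, p i)) = (\<Prod>i<n. x i ^ p i)"
    if "p permutes {0..<n}" for p
  proof -
    have "p i < n" if "i < n" for i
      using \<open>p permutes {0..<n}\<close> that by (metis atLeastLessThan_iff permutes_in_image zero_le)
    then show ?thesis by (auto simp: atLeast0LessThan intro!: prod.cong)
  qed
  then show ?thesis
    unfolding vandermonde_det_def det_def by (auto simp: atLeast0LessThan intro!: sum.cong)
qed

lemma vandermonde_det_eq_0:
  assumes "\<not> inj_on x {..<n}"
  shows "vandermonde_det n x = 0"
proof -
  from assms obtain i j where "i < n" "j < n" "i \<noteq> j" "x i = x j"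
    by (auto simp: inj_on_def)
  then show ?thesis
    unfolding vandermonde_det_def
    by (intro det_identical_rows[of _ n i j]) (auto simp: row_def)
qed

text \<open>The exponents of each Leibniz term permute 0, ..., n - 1, so all terms have the same
  degree.\<close>

lemma poly_deg_less_vandermonde_det:
  "poly_deg_less n (Suc (\<Sum>i<n. i)) (vandermonde_det n)"
proof -
  have "poly_deg_less n (Suc (\<Sum>i<n. i))
      (\<lambda>x. \<Sum>p | p permutes {..<n}. signof p * (\<Prod>i<n. x i ^ p i))"
  proof (intro poly_deg_less_sum poly_deg_less_monom)
    fix p assume "p \<in> {p. p permutes {..<n}}"
    then show "(\<Sum>i<n. p i) < Suc (\<Sum>i<n. i)"
      using sum.permute[of p "{..<n}" "\<lambda>i. i"] by (simp add: o_def)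
  qed
  then show ?thesis by (simp add: vandermonde_det_expand[abs_def])
qed

text \<open>Greedy choice: the last summand takes as much as its bound allows, and induction
  distributes the rest.\<close>

lemma exists_bounded_summands:
  fixes M :: "nat \<Rightarrow> nat"
  assumes "N \<le> (\<Sum>i<n. M i)"
  shows "\<exists>m. (\<forall>i<n. m i \<le> M i) \<and> (\<Sum>i<n. m i) = N"
  using assms
proof (induction n arbitrary: N)
  case 0
  then show ?case by simp
next
  case (Suc n)
  then have "N - min N (M n) \<le> (\<Sum>i<n. M i)" by auto
  from Suc.IH[OF this] obtain m where m: "\<forall>i<n. m i \<le> M i" "(\<Sum>i<n. m i) = N - min N (M n)"
    by blast
  have "(\<Sum>i<n. (m(n := min N (M n))) i) = (\<Sum>i<n. m i)" by (intro sum.cong) auto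
  then show ?case
    using m by (intro exI[of _ "m(n := min N (M n))"]) (auto simp: less_Suc_eq)
qed

text \<open>The annihilating product must have exactly \<open>N\<close> factors even if there are
  fewer values; surplus terms of \<open>c\<close> are arbitrary.\<close>

lemma cover_by_sequence:
  assumes "finite S" "card S \<le> N"
  shows "\<exists>c :: nat \<Rightarrow> 'a. S \<subseteq> c ` {..<N}"
proof -
  obtain c where "bij_betw c {0..<card S} S"
    using ex_bij_betw_nat_finite[OF assms(1)] by blast
  then have "S = c ` {0..<card S}" by (simp add: bij_betw_def)
  moreover have "{0..<card S} \<subseteq> {..<N}" using assms(2) by auto
  ultimately show ?thesis by (metis image_mono)
qed

section \<open>Counting values by a vanishing coefficient\<close>

definition distinct_values :: "nat \<Rightarrow> 'a set \<Rightarrow> ((nat \<Rightarrow> 'a) \<Rightarrow> 'b) \<Rightarrow> 'b set" where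
  "distinct_values n A F = F ` {x. x ` {..<n} \<subseteq> A \<and> inj_on x {..<n}}"

text \<open>The arguments are total functions on the naturals, but \<open>F\<close> depends only on
  the first \<open>n\<close> coordinates, so their restrictions already yield every value.\<close>

lemma finite_distinct_values:
  assumes "finite A" "poly_deg_less n D F"
  shows "finite (distinct_values n A F)"
proof (rule finite_subset)
  show "distinct_values n A F \<subseteq> F ` PiE {..<n} (\<lambda>_. A)"
  proof
    fix v assume "v \<in> distinct_values n A F"
    then obtain x where x: "x ` {..<n} \<subseteq> A" "v = F x" by (auto simp: distinct_values_def)
    then have "restrict x {..<n} \<in> PiE {..<n} (\<lambda>_. A)" by auto
    moreover have "v = F (restrict x {..<n})"
      unfolding x(2) by (rule poly_deg_less_cong[OF assms(2)]) simp
    ultimately show "v \<in> F ` PiE {..<n} (\<lambda>_. A)" by blast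
  qed
  show "finite (F ` PiE {..<n} (\<lambda>_. A))"
    using assms(1) by (intro finite_imageI finite_PiE) auto
qed

text \<open>\<open>N\<close> is left free below the sum so that it can later be capped under the
  characteristic, which enters only through the nonvanishing of \<open>fact N\<close>.\<close>

lemma card_distinct_values_gt:
  fixes A :: "'a::field set"
  assumes fin: "finite A" and k: "k \<ge> 1" "n \<le> k" and nA: "n \<le> card A"
    and a: "\<And>i. i < n \<Longrightarrow> a i \<noteq> 0" and g: "poly_deg_less n k g"
    and N: "N \<le> (\<Sum>i<n. (card A - Suc i) div k)" and fact: "(of_nat (fact N) :: 'a) \<noteq> 0"
  shows "N < card (distinct_values n A (\<lambda>x. (\<Sum>i<n. a i * x i ^ k) + g x))"
proof (rule ccontr)
  define T where "T x = (\<Sum>i<n. a i * x i ^ k)" for x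
  have "finite (distinct_values n A (\<lambda>x. T x + g x))"
    unfolding T_def using fin poly_deg_less_power_sum_add[OF g] by (rule finite_distinct_values)
  moreover assume "\<not> ?thesis"
  ultimately obtain c where c: "distinct_values n A (\<lambda>x. T x + g x) \<subseteq> c ` {..<N}"
    using cover_by_sequence unfolding T_def by (meson not_le)
  from exists_bounded_summands[OF N] obtain m
    where m: "\<And>i. i < n \<Longrightarrow> m i \<le> (card A - Suc i) div k" "(\<Sum>i<n. m i) = N" by blast
  define d where "d i = i + k * m i" for i
  \<comment> \<open>The quotients were chosen for this: \<open>A\<close> has room for a box side
    with \<open>Suc (d i)\<close> points. By \<open>n \<le> card A\<close> the subtraction is not
    truncated.\<close>
  have "Suc (d i) \<le> card A" if "i < n" for i
  proof -
    have "k * m i \<le> k * ((card A - Suc i) div k)" using m(1)[OF that] by simp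
    also have "\<dots> \<le> card A - Suc i" by simp
    finally show ?thesis using that nA by (simp add: d_def)
  qed
  then have "\<exists>B. i < n \<longrightarrow> B \<subseteq> A \<and> card B = Suc (d i) \<and> finite B" for i
    by (metis obtain_subset_with_card_n)
  then obtain B where B: "\<And>i. i < n \<Longrightarrow> B i \<subseteq> A \<and> card (B i) = Suc (d i) \<and> finite (B i)"
    by metis
  then have "\<exists>w. i < n \<longrightarrow> (\<forall>e\<le>d i. (\<Sum>b\<in>B i. w b * b ^ e) = (if e = d i then 1 else 0))" for i
    using top_power_weights_exist by metis
  then obtain w where
    "\<And>i e. i < n \<Longrightarrow> e \<le> d i \<Longrightarrow> (\<Sum>b\<in>B i. w i b * b ^ e) = (if e = d i then 1 else 0)"
    by metis
  then interpret top_monomial_weights n d B w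
    using B by unfold_locales auto
  define V where "V = (vandermonde_det n :: (nat \<Rightarrow> 'a) \<Rightarrow> 'a)"
  define h where "h x = (\<Prod>j<N. T x + g x - c j) - T x ^ N" for x
  \<comment> \<open>\<open>k * N\<close> is the degree of \<open>T x ^ N\<close>, the rest that of
    the Vandermonde determinant.\<close>
  have sumd: "(\<Sum>i<n. d i) = k * N + (\<Sum>i<n. i)"
    using m(2) by (simp add: d_def sum.distrib flip: sum_distrib_left)

  have "L (\<lambda>x. (\<Prod>j<N. T x + g x - c j) * V x) = 0"
    unfolding weighted_sum_def
  proof (intro sum.neutral ballI)
    fix x assume x: "x \<in> PiE {..<n} B"
    have "(\<Prod>j<N. T x + g x - c j) * V x = 0"
    \<comment> \<open>Repeated arguments kill the determinant; distinct ones give a value among the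
      \<open>c j\<close> and kill the product.\<close>
    proof (cases "inj_on x {..<n}")
      case True
      moreover have "x ` {..<n} \<subseteq> A" using x B by (fastforce simp: PiE_iff)
      ultimately have "T x + g x \<in> c ` {..<N}"
        using c by (auto simp: distinct_values_def)
      then show ?thesis by (auto intro!: prod_zero)
    qed (simp add: V_def vandermonde_det_eq_0)
    then show "(\<Prod>i<n. w i (x i)) * ((\<Prod>j<N. T x + g x - c j) * V x) = 0" by simp
  qed
  moreover have "L (\<lambda>x. h x * V x) = 0"
  proof (rule L_low_degree)
    have "poly_deg_less n (k * N) h"
      unfolding h_def T_def
      using poly_deg_less_prod_diff_power[OF poly_deg_less_power_sum g k(1)] .
    then show "poly_deg_less n (\<Sum>i<n. d i) (\<lambda>x. h x * V x)"
      unfolding sumd V_def by (rule poly_deg_less_mult[OF _ poly_deg_less_vandermonde_det])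
  qed
  moreover have "(\<lambda>x. (\<Prod>j<N. T x + g x - c j) * V x) = (\<lambda>x. T x ^ N * V x + h x * V x)"
    by (simp add: h_def algebra_simps)
  ultimately have zero: "L (\<lambda>x. T x ^ N * V x) = 0"
    by (simp add: weighted_sum_add)

  define \<Phi> where "\<Phi> p = L (\<lambda>x. T x ^ N * (\<Prod>i<n. x i ^ p i))" for p
  have "(\<lambda>x. T x ^ N * V x) =
      (\<lambda>x. \<Sum>p | p permutes {..<n}. signof p * (T x ^ N * (\<Prod>i<n. x i ^ p i)))"
    by (simp add: V_def vandermonde_det_expand sum_distrib_left algebra_simps)
  then have "L (\<lambda>x. T x ^ N * V x) = (\<Sum>p | p permutes {..<n}. signof p * \<Phi> p)"
    by (simp add: weighted_sum_sum weighted_sum_mult_left \<Phi>_def)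
  also have "\<dots> = (\<Sum>p | p permutes {..<n}. if p = id then \<Phi> id else 0)"
  proof (intro sum.cong refl)
    fix p assume "p \<in> {p. p permutes {..<n}}"
    then have p: "p permutes {..<n}" by simp
    show "signof p * \<Phi> p = (if p = id then \<Phi> id else 0)"
    proof (cases "p = id")
      case False
      then obtain i where i: "p i \<noteq> i" by (auto simp: fun_eq_iff)
      with p have "i < n" by (metis lessThan_iff permutes_not_in)
      moreover from this p have "p i < n" by (metis lessThan_iff permutes_in_image)
      moreover have "d i \<noteq> p i + k * m'" for m'
      proof
        assume "d i = p i + k * m'"
        \<comment> \<open>Both \<open>i\<close> and \<open>p i\<close> lie below
          \<open>n \<le> k\<close>, so equality modulo \<open>k\<close> forces
          \<open>p i = i\<close>.\<close>
        then have "(i + k * m i) mod k = (p i + k * m') mod k" by (simp add: d_def)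
        then show False using i \<open>i < n\<close> \<open>p i < n\<close> k by simp
      qed
      moreover have "(\<Sum>i<n. p i) + k * N = (\<Sum>i<n. d i)"
        using sum.permute[OF p, of "\<lambda>i. i"] by (simp add: sumd o_def)
      ultimately show ?thesis
        using False by (simp add: \<Phi>_def T_def L_power_sum_eq_0)
    qed simp
  qed
  also have "\<dots> = \<Phi> id"
    by (simp add: sum.delta finite_permutations permutes_id)
  finally have "\<Phi> id = 0" using zero by simp
  moreover have "(\<Prod>i<n. of_nat (fact (m i))) * \<Phi> id = of_nat (fact N) * (\<Prod>i<n. a i ^ m i)"
    unfolding \<Phi>_def T_def by (rule L_power_sum) (use m(2) k(1) in \<open>auto simp: d_def\<close>)
  ultimately have "of_nat (fact N) * (\<Prod>i<n. a i ^ m i) = 0" by simp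
  then show False using fact a by simp
qed

section \<open>Explicit lower bounds\<close>

lemma of_nat_fact_neq_0:
  assumes "CHAR('a::field) = 0 \<or> N < CHAR('a)"
  shows "(of_nat (fact N) :: 'a) \<noteq> 0"
proof (cases "CHAR('a) = 0")
  case True
  then show ?thesis by (simp add: of_nat_eq_0_iff_char_dvd)
next
  case False
  then have "prime CHAR('a)" by (simp add: prime_CHAR_semidom)
  then show ?thesis
    using assms False by (simp add: of_nat_eq_0_iff_char_dvd prime_dvd_fact_iff)
qed

text \<open>The integer \<open>b\<close> lets each case of the theorem supply its own closed form,
  possibly negative.\<close>

lemma card_distinct_values_ge:
  fixes A :: "'a::field set"
  assumes "finite A" "k \<ge> 1" "n \<le> k" "n \<le> card A"
    and "\<And>i. i < n \<Longrightarrow> a i \<noteq> 0" and "poly_deg_less n k g"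
    and b: "b \<le> int (\<Sum>i<n. (card A - Suc i) div k) + 1"
  shows "min (add_order_one TYPE('a)) (ereal (real_of_int b))
    \<le> ereal (real (card (distinct_values n A (\<lambda>x. (\<Sum>i<n. a i * x i ^ k) + g x))))"
proof -
  define M where "M = (\<Sum>i<n. (card A - Suc i) div k)"
  \<comment> \<open>The largest admissible \<open>N\<close>: in positive characteristic
    \<open>Suc N\<close> is the minimum of the characteristic and \<open>Suc M\<close>.\<close>
  define N where "N = (if CHAR('a) = 0 then M else min M (CHAR('a) - 1))"
  have "N < card (distinct_values n A (\<lambda>x. (\<Sum>i<n. a i * x i ^ k) + g x))"
    using assms(1-6)
  proof (rule card_distinct_values_gt)
    show "N \<le> (\<Sum>i<n. (card A - Suc i) div k)" by (simp add: N_def M_def)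
    show "(of_nat (fact N) :: 'a) \<noteq> 0" by (rule of_nat_fact_neq_0) (auto simp: N_def)
  qed
  then show ?thesis
    using b by (auto simp: add_order_one_def N_def min_le_iff_disj simp flip: M_def split: if_splits)
qed

text \<open>The quotient is \<open>q\<close> for \<open>i < r\<close>. For
  \<open>r \<le> i < k\<close> subtracting \<open>Suc i\<close> borrows exactly one
  \<open>k\<close>, so it is \<open>q - 1\<close>.\<close>

lemma sum_div_consecutive:
  assumes "r < k" "n \<le> k" "n \<le> k * q + r"
  shows "int (\<Sum>i<n. (k * q + r - Suc i) div k) = int n * (int q - 1) + int (min n r)"
proof -
  have "int ((k * q + r - Suc i) div k) = (int q - 1) + (if i < r then 1 else 0)"
    if "i < n" for i
  proof (cases "i < r")
    case True
    then have "k * q + r - Suc i = (r - Suc i) + k * q" by simp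
    moreover have "r - Suc i < k" using assms(1) by simp
    ultimately show ?thesis using True by (simp only: div_mult_self2 div_less) simp
  next
    case False
    \<comment> \<open>With \<open>q = 0\<close> the assumption gives \<open>n \<le> r\<close>, hence
      \<open>i < r\<close>.\<close>
    then have "q \<noteq> 0" using assms(3) that by (cases q) auto
    then obtain q' where "q = Suc q'" by (cases q) auto
    then have "k * q + r - Suc i = (k + r - Suc i) + k * q'" using that assms(2) by simp
    moreover have "k + r - Suc i < k" using False that assms by simp
    ultimately show ?thesis using False \<open>q = Suc q'\<close> by simp
  qed
  then have "int (\<Sum>i<n. (k * q + r - Suc i) div k) =
      (\<Sum>i<n. (int q - 1) + (if i < r then 1 else 0))"
    by simp
  also have "\<dots> = int n * (int q - 1) + (\<Sum>i<n. if i < r then 1 else 0)"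
    by (simp add: sum.distrib)
  also have "(\<Sum>i<n. if i < r then 1 else 0) = (\<Sum>i\<in>{..<n} \<inter> {..<r}. 1 :: int)"
    by (subst sum.inter_restrict) auto
  also have "{..<n} \<inter> {..<r} = {..<min n r}" by auto
  finally show ?thesis by simp
qed

text \<open>For \<open>n > card A\<close>, when no distinct arguments exist, both bounds of the
  theorem are nonpositive.\<close>

lemma min_ereal_nonpos_le:
  assumes "b \<le> 0"
  shows "min B (ereal (real_of_int b)) \<le> ereal (real N)"
proof -
  have "real_of_int b \<le> real N" using assms by linarith
  then show ?thesis by (simp add: min_le_iff_disj)
qed

lemma card_distinct_values_ge_few_variables:
  fixes A :: "'a::field set"
  assumes "finite A" "k \<ge> 1" "n \<le> k"
    and "\<And>i. i < n \<Longrightarrow> a i \<noteq> 0" and "poly_deg_less n k g"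
    and "card A = k * q + r" "r < k"
  shows "min (add_order_one TYPE('a)) (ereal (real_of_int (int n * (int q - 1) + int (min n r) + 1)))
    \<le> ereal (real (card (distinct_values n A (\<lambda>x. (\<Sum>i<n. a i * x i ^ k) + g x))))"
proof (cases "n \<le> card A")
  case True
  show ?thesis
    using assms(1-3) True assms(4-5)
    by (rule card_distinct_values_ge) (use assms True sum_div_consecutive[of r k n q] in simp_all)
next
  case False
  \<comment> \<open>Since \<open>card A < n \<le> k\<close>, the remainder \<open>r\<close> is all
    of \<open>card A\<close>, and the bound becomes \<open>r - n + 1\<close>.\<close>
  then have "q = 0" using assms(3,6) by (cases q) auto
  then have "int n * (int q - 1) + int (min n r) + 1 \<le> 0" using False assms(6) by simp
  then show ?thesis by (rule min_ereal_nonpos_le)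
qed

lemma card_distinct_values_ge_many_variables:
  fixes A :: "'a::field set"
  assumes fin: "finite A" and k: "k \<ge> 1" "k \<le> n"
    and a: "\<And>i. i < n \<Longrightarrow> a i \<noteq> 0" and g: "poly_deg_less n k g"
  shows "min (add_order_one TYPE('a)) (ereal (real_of_int (int (card A) - int n + 1)))
    \<le> ereal (real (card (distinct_values n A (\<lambda>x. (\<Sum>i<n. a i * x i ^ k) + g x))))"
proof (cases "n \<le> card A")
  case False
  then show ?thesis by (intro min_ereal_nonpos_le) simp
next
  case True
  define F where "F x = (\<Sum>i<n. a i * x i ^ k) + g x" for x
  obtain C where C: "C \<subseteq> A" "card C = n - k" "finite C"
    by (meson True diff_le_self le_trans obtain_subset_with_card_n)
  then obtain b where b: "bij_betw b {k..<n} C"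
    using finite_same_card_bij[of "{k..<n}" C] by auto
  define ext where "ext x i = (if i < k then x i else b i)" for x and i :: nat
  define h where "h x = (\<Sum>i=k..<n. a i * b i ^ k) + g (ext x)" for x
  have cardD: "card (A - C) = card A - (n - k)"
    using C fin by (simp add: card_Diff_subset)
  have F_ext: "F (ext x) = (\<Sum>i<k. a i * x i ^ k) + h x" for x
  proof -
    have "{..<n} = {..<k} \<union> {k..<n}" using k by auto
    then show ?thesis
      unfolding F_def h_def
      by (simp add: sum.union_disjoint[of "{..<k}" "{k..<n}"] ivl_disj_int ext_def algebra_simps)
  qed
  have "distinct_values k (A - C) (\<lambda>x. (\<Sum>i<k. a i * x i ^ k) + h x) \<subseteq> distinct_values n A F"
  proof
    fix v assume "v \<in> distinct_values k (A - C) (\<lambda>x. (\<Sum>i<k. a i * x i ^ k) + h x)"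
    then obtain x where x: "x ` {..<k} \<subseteq> A - C" "inj_on x {..<k}" "v = F (ext x)"
      by (auto simp: distinct_values_def F_ext)
    have bC: "b i \<in> C" if "k \<le> i" "i < n" for i
      using b that by (auto simp: bij_betw_def)
    have "ext x ` {..<n} \<subseteq> A"
      using x(1) bC C(1) by (auto simp: ext_def)
    moreover have "inj_on (ext x) {..<n}"
    proof (rule inj_onI)
      fix i j assume ij: "i \<in> {..<n}" "j \<in> {..<n}" "ext x i = ext x j"
      have xC: "x l \<notin> C" if "l < k" for l using x(1) that by auto
      consider "i < k" "j < k" | "i < k" "k \<le> j" | "k \<le> i" "j < k" | "k \<le> i" "k \<le> j"
        by linarith
      then show "i = j"
      proof cases
        case 1
        then show ?thesis using ij x(2) by (auto simp: ext_def inj_on_def)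
      next
        case 2
        then show ?thesis using ij xC[of i] bC[of j] by (auto simp: ext_def)
      next
        case 3
        then show ?thesis using ij xC[of j] bC[of i] by (auto simp: ext_def)
      next
        case 4
        then show ?thesis using ij b by (auto simp: ext_def bij_betw_def inj_on_def)
      qed
    qed
    ultimately show "v \<in> distinct_values n A F"
      using x(3) by (auto simp: distinct_values_def)
  qed
  moreover have "finite (distinct_values n A F)"
    unfolding F_def using fin poly_deg_less_power_sum_add[OF g] by (rule finite_distinct_values)
  ultimately have "card (distinct_values k (A - C) (\<lambda>x. (\<Sum>i<k. a i * x i ^ k) + h x))
      \<le> card (distinct_values n A F)"
    by (intro card_mono)
  moreover have "min (add_order_one TYPE('a)) (ereal (real_of_int (int (card A) - int n + 1)))
    \<le> ereal (real (card (distinct_values k (A - C) (\<lambda>x. (\<Sum>i<k. a i * x i ^ k) + h x))))"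
  proof (rule card_distinct_values_ge)
    show "poly_deg_less k k h"
      unfolding h_def ext_def
      using k by (intro poly_deg_less_add poly_deg_less_const poly_deg_less_fix_tail[OF g]) auto
    define q r where "q = card (A - C) div k" and "r = card (A - C) mod k"
    have qr: "card (A - C) = k * q + r" "r < k" using k by (simp_all add: q_def r_def)
    have "k \<le> card (A - C)" using cardD True k by simp
    then have "int (\<Sum>i<k. (card (A - C) - Suc i) div k) = int k * (int q - 1) + int (min k r)"
      using sum_div_consecutive[of r k k q] qr by simp
    \<comment> \<open>With \<open>k\<close> variables \<open>min k r = r\<close>, so the quotients
      sum to \<open>k * q + r - k\<close>.\<close>
    also have "\<dots> = int (card (A - C)) - int k"
      using qr by (simp add: algebra_simps)
    also have "\<dots> = int (card A) - int n"
      using cardD True k by simp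
    finally show "int (card A) - int n + 1 \<le> int (\<Sum>i<k. (card (A - C) - Suc i) div k) + 1"
      by simp
  qed (use fin k a True cardD in auto)
  ultimately show ?thesis
    unfolding F_def by (meson ereal_less_eq(3) of_nat_le_iff order_trans)
qed

section \<open>Evaluation of multivariate polynomials\<close>

text \<open>Cancellation may shrink the keys of a sum; a common finite index set makes evaluation
  visibly additive.\<close>

lemma mpoly_eval_superset:
  assumes "finite M" "Poly_Mapping.keys p \<subseteq> M"
  shows "mpoly_eval p x = (\<Sum>m\<in>M. Poly_Mapping.lookup p m *
    (\<Prod>i\<in>Poly_Mapping.keys m. x i ^ Poly_Mapping.lookup m i))"
  unfolding mpoly_eval_def
  using assms by (intro sum.mono_neutral_left) (auto simp: in_keys_iff)

lemma mpoly_eval_add: "mpoly_eval (p + q) x = mpoly_eval p x + mpoly_eval q x"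
proof -
  let ?M = "Poly_Mapping.keys p \<union> Poly_Mapping.keys q"
  have "Poly_Mapping.keys (p + q) \<subseteq> ?M" by (rule Poly_Mapping.keys_add)
  then show ?thesis
    by (simp add: mpoly_eval_superset[of ?M] lookup_add algebra_simps sum.distrib)
qed

lemma mpoly_eval_sum: "mpoly_eval (\<Sum>j\<in>J. p j) x = (\<Sum>j\<in>J. mpoly_eval (p j) x)"
  by (induction J rule: infinite_finite_induct)
    (simp_all add: mpoly_eval_add, simp_all add: mpoly_eval_def)

lemma Var_power: "Var i ^ k = Poly_Mapping.single (Poly_Mapping.single i k) (1 :: 'a::comm_semiring_1)"
  by (induction k) (simp_all add: Var_def mult_single flip: single_add single_one)

lemma mpoly_eval_Const_mult_Var_power:
  "mpoly_eval (Const c * Var i ^ k) x = c * x i ^ k"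
  by (auto simp: Const_def Var_power mult_single mpoly_eval_def)

lemma mpoly_eval_cong:
  assumes "p \<in> mpolys V" "\<And>i. i \<in> V \<Longrightarrow> x i = y i"
  shows "mpoly_eval p x = mpoly_eval p y"
  unfolding mpoly_eval_def
  using assms
  by (intro sum.cong prod.cong arg_cong2[where f = "(*)"] refl) (auto simp: mpolys_def subset_iff)

text \<open>Bridges formal polynomials in variables 1, ..., n and functions indexed from 0. Indices
  missing from a monomial have exponent 0 and change neither product nor degree.\<close>

lemma poly_deg_less_mpoly_eval:
  fixes g :: "'a::comm_ring_1 mpoly"
  assumes "g \<in> mpolys {1..n}" "total_degree g < k"
  shows "poly_deg_less n k (\<lambda>y. mpoly_eval g (\<lambda>i. y (i - 1)))"
  unfolding mpoly_eval_def
proof (rule poly_deg_less_sum)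
  fix m assume m: "m \<in> Poly_Mapping.keys g"
  then have sub: "Poly_Mapping.keys m \<subseteq> {Suc 0..n}" using assms(1) by (auto simp: mpolys_def)
  have "(\<Prod>i\<in>Poly_Mapping.keys m. y (i - 1) ^ Poly_Mapping.lookup m i) =
      (\<Prod>i<n. y i ^ Poly_Mapping.lookup m (Suc i))" for y :: "nat \<Rightarrow> 'a"
    using sub prod.mono_neutral_left[OF _ sub, of "\<lambda>i. y (i - 1) ^ Poly_Mapping.lookup m i"]
    by (simp add: prod.atLeast1_atMost_eq in_keys_iff)
  moreover have "monom_degree m = (\<Sum>i<n. Poly_Mapping.lookup m (Suc i))"
    using sub sum.mono_neutral_left[OF _ sub, of "Poly_Mapping.lookup m"]
    by (simp add: monom_degree_def sum.atLeast1_atMost_eq in_keys_iff)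
  moreover have "monom_degree m \<le> total_degree g"
    using m by (simp add: total_degree_def)
  ultimately show "poly_deg_less n k (\<lambda>y. Poly_Mapping.lookup g m *
      (\<Prod>i\<in>Poly_Mapping.keys m. y (i - 1) ^ Poly_Mapping.lookup m i))"
    using assms(2) by (simp only:) (rule poly_deg_less_monom, simp)
qed

theorem corollary1p4:
  fixes A :: "'a::field set"
    and n k q r :: nat
    and a :: "nat \<Rightarrow> 'a"
    and f g :: "'a mpoly"
  assumes "finite A"
    and "n \<ge> 1" and "k \<ge> 1"
    and "\<And>i. i \<in> {1..n} \<Longrightarrow> a i \<noteq> 0"
    and "g \<in> mpolys {1..n}" and "total_degree g < k"
    and "f = (\<Sum>i=1..n. Const (a i) * Var i ^ k) + g"
    and "card A = k * q + r" and "r < k"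
  defines "S \<equiv> {mpoly_eval f x | x. (\<forall>i\<in>{1..n}. x i \<in> A) \<and>
                  (\<forall>i\<in>{1..n}. \<forall>j\<in>{1..n}. i \<noteq> j \<longrightarrow> x i \<noteq> x j)}"
  shows "(n \<le> k \<longrightarrow> ereal (real (card S)) \<ge>
            min (add_order_one TYPE('a))
                (ereal (real_of_int (int n * (int q - 1) + int (min n r) + 1)))) \<and>
         (n \<ge> k \<longrightarrow> ereal (real (card S)) \<ge>
            min (add_order_one TYPE('a))
                (ereal (real_of_int (int (card A) - int n + 1))))"
proof -
  define G where "G y = mpoly_eval g (\<lambda>i. y (i - 1))" for y
  have f_eval: "mpoly_eval f x = (\<Sum>i<n. a (Suc i) * x (Suc i) ^ k) + G (\<lambda>i. x (Suc i))" for x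
  proof -
    \<comment> \<open>The two argument functions can differ only at index 0 (where
      \<open>i - 1\<close> truncates), and \<open>g\<close> has no such variable.\<close>
    have "mpoly_eval g x = G (\<lambda>i. x (Suc i))"
      unfolding G_def using assms(5) by (rule mpoly_eval_cong) auto
    then show ?thesis
      by (simp add: assms(7) mpoly_eval_add mpoly_eval_sum mpoly_eval_Const_mult_Var_power
          sum.atLeast1_atMost_eq)
  qed
  have "S = distinct_values n A (\<lambda>y. (\<Sum>i<n. a (Suc i) * y i ^ k) + G y)" (is "S = ?T")
  proof
    show "S \<subseteq> ?T"
    proof
      fix v assume "v \<in> S"
      then obtain x where x: "v = mpoly_eval f x" "\<forall>i\<in>{1..n}. x i \<in> A"
        "\<forall>i\<in>{1..n}. \<forall>j\<in>{1..n}. i \<noteq> j \<longrightarrow> x i \<noteq> x j" by (auto simp: S_def)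
      have "inj_on (\<lambda>i. x (Suc i)) {..<n}"
      proof (rule inj_onI)
        fix i j assume "i \<in> {..<n}" "j \<in> {..<n}" "x (Suc i) = x (Suc j)"
        then show "i = j" using x(3)[rule_format, of "Suc i" "Suc j"] by auto
      qed
      then show "v \<in> ?T"
        using x(1,2) unfolding distinct_values_def f_eval
        by (intro image_eqI[of _ _ "\<lambda>i. x (Suc i)"]) auto
    qed
    show "?T \<subseteq> S"
    proof
      fix v assume "v \<in> ?T"
      then obtain y where y: "y ` {..<n} \<subseteq> A" "inj_on y {..<n}"
        "v = (\<Sum>i<n. a (Suc i) * y i ^ k) + G y" by (auto simp: distinct_values_def)
      have "v = mpoly_eval f (\<lambda>i. y (i - 1))" by (simp add: y(3) f_eval)
      moreover have "y (i - 1) \<noteq> y (j - 1)" if "i \<in> {1..n}" "j \<in> {1..n}" "i \<noteq> j" for i j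
      proof -
        have "i - 1 \<in> {..<n}" "j - 1 \<in> {..<n}" "i - 1 \<noteq> j - 1" using that by auto
        then show ?thesis using y(2) by (metis inj_onD)
      qed
      moreover have "y (i - 1) \<in> A" if "i \<in> {1..n}" for i
        using that y(1) by auto
      ultimately show "v \<in> S" unfolding S_def by blast
    qed
  qed
  moreover have "poly_deg_less n k G"
    unfolding G_def using assms(5,6) by (rule poly_deg_less_mpoly_eval)
  moreover have "\<And>i. i < n \<Longrightarrow> a (Suc i) \<noteq> 0" using assms(4) by simp
  ultimately show ?thesis
    using assms(1,3,8,9) card_distinct_values_ge_few_variables[of A k n "\<lambda>i. a (Suc i)" G q r]
      card_distinct_values_ge_many_variables[of A k n "\<lambda>i. a (Suc i)" G]
    by simp
qed

end
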